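(* Let $v_{i,j}=(v_{i,j}^1,v_{i,j}^2,\dots,v_{i,j}^d)^T\in\mathbb{R}^d$ for all $1\leq i<j\leq s$. Assume that: (1) For all $1\leq i<j\leq s$ and all $1\leq a\leq d$ we have $v_{i,j}^a\in[0,1]$, and $\sum_{a=1}^d v_{i,j}^a=1$. (2) For every $1\leq i<j<k\leq s$ there exist real numbers $a_{i,j,k}>0$, $b_{i,j,k}>0$, $c_{i,j,k}>0$ such that $a_{i,j,k}v_{i,j}-b_{i,j,k}v_{i,k}+c_{i,j,k}v_{j,k}=0$. (3) For every $1\leq i<j<k<l\leq s$ and all $1\leq a\leq d$ there exists $b\in\{1,\dots,d\}$ (depending on $a,i,j,k,l$) such that $$\mathrm{rank}\begin{bmatrix}v_{i_1,i_2}^a&v_{i_1,i_3}^a&v_{i_2,i_3}^a\\ v_{i_1,i_2}^b&v_{i_1,i_3}^b&v_{i_2,i_3}^b\end{bmatrix}=2$$ for all $i_1<i_2<i_3$ in $\{i,j,k,l\}$. (4) The $S^2$-rank of $(v_{i,j})_{1\leq i<j\leq s}$ is $1$. Then there exist two random variables $X:(0,1]\to\{1,2,\dots,s\}$ and $Y:(0,1]\to\{1,2,\dots,d\}$, where $(0,1]$ carries the probability $P$ given by the standard (Lebesgue) measure, such that $$v_{i,j}^a=P(Y=a\mid i<X\leq j)$$ for all $1\leq i<j\leq s$ and $1\leq a\leq d$.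
   Context: Here $P(Y=a\mid i<X\leq j)=\frac{P(Y=a,\;i<X\leq j)}{P(i<X\leq j)}$ is the usual conditional probability (the conclusion includes that it is defined, i.e. $P(i<X\leq j)>0$). The map $det^{S^2}$: for a family $(w_{i,j})_{1\leq i<j\leq 4}$ of vectors $w_{i,j}=\begin{bmatrix}\alpha_{i,j}\\ \beta_{i,j}\end{bmatrix}\in\mathbb{R}^2$, \begin{align*} det^{S^2}((w_{i,j})_{1\leq i<j\leq 4})=\;&\alpha_{1,2}\alpha_{2,3}\alpha_{3,4}\beta_{1,3}\beta_{2,4}\beta_{1,4}+\alpha_{1,2}\beta_{2,3}\alpha_{3,4}\beta_{1,3}\beta_{2,4}\alpha_{1,4}+\alpha_{1,2}\beta_{2,3}\beta_{3,4}\alpha_{1,3}\alpha_{2,4}\beta_{1,4}\\ &+\beta_{1,2}\beta_{2,3}\alpha_{3,4}\alpha_{1,3}\alpha_{2,4}\beta_{1,4}+\beta_{1,2}\alpha_{2,3}\beta_{3,4}\beta_{1,3}\alpha_{2,4}\alpha_{1,4}+\beta_{1,2}\alpha_{2,3}\beta_{3,4}\alpha_{1,3}\beta_{2,4}\alpha_{1,4}\\ &-\beta_{1,2}\beta_{2,3}\beta_{3,4}\alpha_{1,3}\alpha_{2,4}\alpha_{1,4}-\beta_{1,2}\alpha_{2,3}\beta_{3,4}\alpha_{1,3}\alpha_{2,4}\beta_{1,4}-\beta_{1,2}\alpha_{2,3}\alpha_{3,4}\beta_{1,3}\beta_{2,4}\alpha_{1,4}\\ &-\alpha_{1,2}\alpha_{2,3}\beta_{3,4}\beta_{1,3}\beta_{2,4}\alpha_{1,4}-\alpha_{1,2}\beta_{2,3}\alpha_{3,4}\alpha_{1,3}\beta_{2,4}\beta_{1,4}-\alpha_{1,2}\beta_{2,3}\alpha_{3,4}\beta_{1,3}\alpha_{2,4}\beta_{1,4}.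 \end{align*} $S^2$-rank equal to $1$: let $\mathfrak{V}=(v_{i,j})_{1\leq i<j\leq s}$ be a nonzero family of vectors $v_{i,j}=(v_{i,j}^1,\dots,v_{i,j}^d)\in\mathbb{R}^d$ (nonzero meaning not all $v_{i,j}$ are zero). For $1\leq x_1<x_2<x_3<x_4\leq s$ and $1\leq a_1<a_2\leq d$, the $2$-minor $M_{x_1,x_2,x_3,x_4}^{a_1,a_2}(\mathfrak{V})$ is the family $(w_{i,j})_{1\leq i<j\leq 4}$ in $\mathbb{R}^2$ with $w_{i,j}=\begin{bmatrix}v_{x_i,x_j}^{a_1}\\ v_{x_i,x_j}^{a_2}\end{bmatrix}$. One says that $\mathfrak{V}$ has $S^2$-rank equal to $1$ if $det^{S^2}(M_{x_1,x_2,x_3,x_4}^{a_1,a_2}(\mathfrak{V}))=0$ for every $1\leq x_1<x_2<x_3<x_4\leq s$ and every $1\leq a_1<a_2\leq d$. *)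

theory Defs
  imports "HOL-Probability.Probability"
begin

text \<open>
  A family of vectors v_{i,j} in R^d, for 1 <= i < j <= s, is a function
  v :: nat => nat => nat => real with v i j a the a-th coordinate of v_{i,j}. Only its values at
  1 <= i < j <= s and 1 <= a <= d are meaningful; everything below is relativised to that range.
\<close>

definition det_S2 :: "(nat \<Rightarrow> nat \<Rightarrow> real^2) \<Rightarrow> real" where
  "det_S2 w = (let \<alpha> = (\<lambda>i j. w i j $ 1); \<beta> = (\<lambda>i j. w i j $ 2) in
       \<alpha> 1 2 * \<alpha> 2 3 * \<alpha> 3 4 * \<beta> 1 3 * \<beta> 2 4 * \<beta> 1 4
     + \<alpha> 1 2 * \<beta> 2 3 * \<alpha> 3 4 * \<beta> 1 3 * \<beta> 2 4 * \<alpha> 1 4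
     + \<alpha> 1 2 * \<beta> 2 3 * \<beta> 3 4 * \<alpha> 1 3 * \<alpha> 2 4 * \<beta> 1 4
     + \<beta> 1 2 * \<beta> 2 3 * \<alpha> 3 4 * \<alpha> 1 3 * \<alpha> 2 4 * \<beta> 1 4
     + \<beta> 1 2 * \<alpha> 2 3 * \<beta> 3 4 * \<beta> 1 3 * \<alpha> 2 4 * \<alpha> 1 4
     + \<beta> 1 2 * \<alpha> 2 3 * \<beta> 3 4 * \<alpha> 1 3 * \<beta> 2 4 * \<alpha> 1 4
     - \<beta> 1 2 * \<beta> 2 3 * \<beta> 3 4 * \<alpha> 1 3 * \<alpha> 2 4 * \<alpha> 1 4
     - \<beta> 1 2 * \<alpha> 2 3 * \<beta> 3 4 * \<alpha> 1 3 * \<alpha> 2 4 * \<beta> 1 4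
     - \<beta> 1 2 * \<alpha> 2 3 * \<alpha> 3 4 * \<beta> 1 3 * \<beta> 2 4 * \<alpha> 1 4
     - \<alpha> 1 2 * \<alpha> 2 3 * \<beta> 3 4 * \<beta> 1 3 * \<beta> 2 4 * \<alpha> 1 4
     - \<alpha> 1 2 * \<beta> 2 3 * \<alpha> 3 4 * \<alpha> 1 3 * \<beta> 2 4 * \<beta> 1 4
     - \<alpha> 1 2 * \<beta> 2 3 * \<alpha> 3 4 * \<beta> 1 3 * \<alpha> 2 4 * \<beta> 1 4)"

text \<open>The list index is shifted because x_1, ..., x_4 are numbered from 1.\<close>

definition S2_minor ::
    "(nat \<Rightarrow> nat \<Rightarrow> nat \<Rightarrow> real) \<Rightarrow> nat \<Rightarrow> nat \<Rightarrow> nat \<Rightarrow> nat \<Rightarrow> nat \<Rightarrow> nat \<Rightarrow> nat \<Rightarrow> nat \<Rightarrow> real^2" where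
  "S2_minor v x1 x2 x3 x4 a1 a2 =
     (\<lambda>i j. let x = (\<lambda>k. [x1, x2, x3, x4] ! (k - 1))
            in vector [v (x i) (x j) a1, v (x i) (x j) a2])"

text \<open>
  The notion is only defined for nonzero families, so nonvanishing is part of the predicate;
  in particular it entails s >= 2 and d >= 1.
\<close>

definition S2_rank_one :: "nat \<Rightarrow> nat \<Rightarrow> (nat \<Rightarrow> nat \<Rightarrow> nat \<Rightarrow> real) \<Rightarrow> bool" where
  "S2_rank_one s d v \<longleftrightarrow>
     (\<exists>i j a. 1 \<le> i \<and> i < j \<and> j \<le> s \<and> 1 \<le> a \<and> a \<le> d \<and> v i j a \<noteq> 0) \<and>
     (\<forall>x1 x2 x3 x4 a1 a2.
        1 \<le> x1 \<and> x1 < x2 \<and> x2 < x3 \<and> x3 < x4 \<and> x4 \<le> s \<and> 1 \<le> a1 \<and> a1 < a2 \<and> a2 \<le> d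
        \<longrightarrow> det_S2 (S2_minor v x1 x2 x3 x4 a1 a2) = 0)"

end

(* The twelve-term polynomial det^(S^2) is the obstruction to rescaling the four linear relations of a
   quadruple so that every vector v_ij receives one and the same coefficient in all relations
   containing it: the 2-minors of the triples, which are nonzero by the rank hypothesis, split
   off as factors. Hence there are 0 = T_1 < T_2 < ... < T_s with
   (T_j - T_i) v_ij = T_j v_1j - T_i v_1i, so T_j - T_i is additive over intervals.
   Giving (X, Y) = (m, a) the probability (T_m - T_(m-1)) v_(m-1,m)^a / T_s for m >= 2, the sums over
   i < m <= j telescope to (T_j - T_i) v_ij^a / T_s. *)

theory Submission
  imports Defs
begin

section \<open>Nonvanishing minors and the factorisation of the twelve-term polynomial\<close>

text \<open>As \<open>q\<close> is nonzero, the relation makes the middle column a combination of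
  the outer two. A row dependency of the outer columns therefore extends to the whole matrix, and
  rank 2 forbids it. This turns a rank condition into the nonvanishing of one specific 2x2
  determinant.\<close>

lemma rank_two_imp_minor_nonzero:
  fixes x1 x2 x3 y1 y2 y3 p q r :: real
  assumes rk: "rank (vector [vector [x1, x2, x3], vector [y1, y2, y3]] :: real^3^2) = 2"
    and relx: "p * x1 - q * x2 + r * x3 = 0"
    and rely: "p * y1 - q * y2 + r * y3 = 0"
    and q: "q \<noteq> 0"
  shows "x1 * y3 - x3 * y1 \<noteq> 0"
proof
  assume minor: "x1 * y3 - x3 * y1 = 0"
  define A :: "real^3^2" where "A = vector [vector [x1, x2, x3], vector [y1, y2, y3]]"
  have "inj ((*v) (transpose A))"
    using rk by (simp add: full_rank_injective[symmetric] rank_transpose A_def)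
  then have indep: "c = 0" if "transpose A *v c = 0" for c
    using that by (metis inj_eq matrix_vector_mult_0_right)
  have trivial: "c = 0 \<and> e = 0" if "c * x1 + e * y1 = 0" "c * x3 + e * y3 = 0" for c e
  proof -
    have "q * (c * x2 + e * y2) = c * (q * x2) + e * (q * y2)"
      by (simp add: algebra_simps)
    also have "\<dots> = c * (p * x1 + r * x3) + e * (p * y1 + r * y3)"
      using relx rely by (simp add: algebra_simps)
    also have "\<dots> = p * (c * x1 + e * y1) + r * (c * x3 + e * y3)"
      by (simp add: algebra_simps)
    also have "\<dots> = 0"
      using that by simp
    finally have "c * x2 + e * y2 = 0"
      using q by simp
    with that have "transpose A *v vector [c, e] = 0"
      by (simp add: A_def vec_eq_iff forall_3 matrix_vector_mult_def transpose_def sum_2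
          vector_3 vector_2 mult.commute)
    from indep[OF this] show ?thesis
      by (metis vector_2 zero_index)
  qed
  \<comment> \<open>The coefficients \<open>y1, - x1\<close> kill the first column identically and
    the third by \<open>minor\<close>; \<open>y3, - x3\<close> do so with the roles exchanged. Once
    all outer entries are zero, the coefficients \<open>1, 0\<close> contradict
    \<open>trivial\<close>.\<close>
  have "y1 = 0 \<and> x1 = 0"
    using trivial[of y1 "- x1"] minor by (simp add: algebra_simps)
  moreover have "y3 = 0 \<and> x3 = 0"
    using trivial[of y3 "- x3"] minor by (simp add: algebra_simps)
  ultimately show False
    using trivial[of 1 0] by simp
qed

text \<open>The relations express \<open>v i k\<close>, \<open>v i l\<close> and
  \<open>v k l\<close>, up to scalars, through \<open>v i j\<close>, \<open>v j k\<close> and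
  \<open>v j l\<close>; what remains is a polynomial identity. The first factor vanishes exactly
  when the coefficients \<open>p, q\<close> of the triple \<open>j, k, l\<close> are proportional to
  \<open>g - 1, h - 1\<close>, those that the triples \<open>i, j, k\<close> and
  \<open>i, j, l\<close> give to \<open>v j k\<close> and \<open>v j l\<close>.\<close>

lemma det_S2_minor_factor:
  fixes v :: "nat \<Rightarrow> nat \<Rightarrow> nat \<Rightarrow> real"
  assumes "\<And>c. c \<in> {a, b} \<Longrightarrow> g * v i k c = v i j c + (g - 1) * v j k c"
    and "\<And>c. c \<in> {a, b} \<Longrightarrow> h * v i l c = v i j c + (h - 1) * v j l c"
    and "\<And>c. c \<in> {a, b} \<Longrightarrow> r * v k l c = q * v j l c - p * v j k c"
  shows "g * h * r * det_S2 (S2_minor v i j k l a b) =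
    (p * (h - 1) - q * (g - 1)) *
    (v i j a * v j k b - v j k a * v i j b) *
    (v i j a * v j l b - v j l a * v i j b) *
    (v j k a * v j l b - v j l a * v j k b)"
proof -
  \<comment> \<open>Each monomial contains one entry for each of the six pairs, so \<open>g\<close>,
    \<open>h\<close> and \<open>r\<close> can be absorbed into the vectors they scale without
    dividing.\<close>
  have scale: "g * h * r * det_S2 (S2_minor v i j k l a b) =
    (let a13 = g * v i k a; b13 = g * v i k b; a14 = h * v i l a; b14 = h * v i l b;
         a34 = r * v k l a; b34 = r * v k l b;
         a12 = v i j a; b12 = v i j b; a23 = v j k a; b23 = v j k b; a24 = v j l a; b24 = v j l b in
       a12 * a23 * a34 * b13 * b24 * b14 + a12 * b23 * a34 * b13 * b24 * a14
     + a12 * b23 * b34 * a13 * a24 * b14 + b12 * b23 * a34 * a13 * a24 * b14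
     + b12 * a23 * b34 * b13 * a24 * a14 + b12 * a23 * b34 * a13 * b24 * a14
     - b12 * b23 * b34 * a13 * a24 * a14 - b12 * a23 * b34 * a13 * a24 * b14
     - b12 * a23 * a34 * b13 * b24 * a14 - a12 * a23 * b34 * b13 * b24 * a14
     - a12 * b23 * a34 * a13 * b24 * b14 - a12 * b23 * a34 * b13 * a24 * b14)"
    by (simp add: det_S2_def S2_minor_def Let_def vector_2 algebra_simps)
  show ?thesis
    unfolding scale using assms by (simp add: Let_def) (simp add: algebra_simps)
qed

section \<open>Common weights for all linear relations\<close>

text \<open>The triples \<open>1, 2, j\<close> fix the weights up to scale. Consistency with every
  triple \<open>2, j, k\<close> comes from the vanishing polynomial of the quadruple
  \<open>1, 2, j, k\<close>.\<close>

lemma common_weights_exist: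
  fixes v :: "nat \<Rightarrow> nat \<Rightarrow> nat \<Rightarrow> real" and s d :: nat
  assumes sum_one: "\<And>i j. 1 \<le> i \<Longrightarrow> i < j \<Longrightarrow> j \<le> s \<Longrightarrow> (\<Sum>a=1..d. v i j a) = 1"
    and lin_rel: "\<And>i j k. 1 \<le> i \<Longrightarrow> i < j \<Longrightarrow> j < k \<Longrightarrow> k \<le> s \<Longrightarrow>
      \<exists>p q r :: real. p > 0 \<and> q > 0 \<and> r > 0 \<and>
        (\<forall>a\<in>{1..d}. p * v i j a - q * v i k a + r * v j k a = 0)"
    and rank_two: "\<And>i j k l a. 1 \<le> i \<Longrightarrow> i < j \<Longrightarrow> j < k \<Longrightarrow> k < l \<Longrightarrow> l \<le> s \<Longrightarrow> a \<in> {1..d} \<Longrightarrow>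
      \<exists>b\<in>{1..d}. \<forall>i1\<in>{i, j, k, l}. \<forall>i2\<in>{i, j, k, l}. \<forall>i3\<in>{i, j, k, l}. i1 < i2 \<longrightarrow> i2 < i3 \<longrightarrow>
        rank (vector [vector [v i1 i2 a, v i1 i3 a, v i2 i3 a],
                      vector [v i1 i2 b, v i1 i3 b, v i2 i3 b]] :: real^3^2) = 2"
    and det_zero: "\<And>i j k l a b. 1 \<le> i \<Longrightarrow> i < j \<Longrightarrow> j < k \<Longrightarrow> k < l \<Longrightarrow> l \<le> s \<Longrightarrow>
      1 \<le> a \<Longrightarrow> a < b \<Longrightarrow> b \<le> d \<Longrightarrow> det_S2 (S2_minor v i j k l a b) = 0"
  obtains T :: "nat \<Rightarrow> real"
    where "T 1 = 0"
      and "\<And>i j. 1 \<le> i \<Longrightarrow> i < j \<Longrightarrow> j \<le> s \<Longrightarrow> T i < T j"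
      and "\<And>i j a. 1 \<le> i \<Longrightarrow> i < j \<Longrightarrow> j \<le> s \<Longrightarrow> a \<in> {1..d} \<Longrightarrow>
             (T j - T i) * v i j a = T j * v 1 j a - T i * v 1 i a"
proof -
  \<comment> \<open>Every vector has coordinate sum 1, so adding up the coordinates of a relation
    gives \<open>p - q + r = 0\<close>.\<close>
  have lin_rel_sum: "\<exists>p q r :: real. p > 0 \<and> r > 0 \<and> q = p + r \<and>
        (\<forall>a\<in>{1..d}. p * v i j a - q * v i k a + r * v j k a = 0)"
    if ijk: "1 \<le> i" "i < j" "j < k" "k \<le> s" for i j k
  proof -
    obtain p q r where pqr: "p > 0" "q > 0" "r > 0"
        "\<forall>a\<in>{1..d}. p * v i j a - q * v i k a + r * v j k a = 0"
      using lin_rel[OF ijk] by blast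
    have "0 = (\<Sum>a=1..d. p * v i j a - q * v i k a + r * v j k a)"
      using pqr(4) by simp
    also have "\<dots> = p * (\<Sum>a=1..d. v i j a) - q * (\<Sum>a=1..d. v i k a) + r * (\<Sum>a=1..d. v j k a)"
      by (simp add: sum.distrib sum_subtractf sum_distrib_left)
    also have "\<dots> = p - q + r"
      using sum_one[of i j] sum_one[of i k] sum_one[of j k] ijk by simp
    finally show ?thesis
      using pqr by (intro exI[of _ p] exI[of _ q] exI[of _ r]) simp
  qed
  have "\<exists>t>1. \<forall>a\<in>{1..d}. t * v 1 j a = v 1 2 a + (t - 1) * v 2 j a" if j: "2 < j" "j \<le> s" for j
  proof -
    obtain p q r where pqr: "p > 0" "r > 0" "q = p + r"
        "\<forall>a\<in>{1..d}. p * v 1 2 a - q * v 1 j a + r * v 2 j a = 0"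
      using lin_rel_sum[of 1 2 j] j by auto
    have "q / p * v 1 j a = v 1 2 a + (q / p - 1) * v 2 j a" if "a \<in> {1..d}" for a
      using pqr(1,3) pqr(4)[rule_format, OF that] by (simp add: field_simps)
    moreover have "q / p > 1"
      using pqr by simp
    ultimately show ?thesis by blast
  qed
  then obtain t where t: "\<And>j. 2 < j \<Longrightarrow> j \<le> s \<Longrightarrow> t j > 1"
      "\<And>j a. 2 < j \<Longrightarrow> j \<le> s \<Longrightarrow> a \<in> {1..d} \<Longrightarrow> t j * v 1 j a = v 1 2 a + (t j - 1) * v 2 j a"
    by metis
  \<comment> \<open>\<open>T j\<close> is the coefficient of \<open>v 1 j\<close> in the relation of \<open>1, 2, j\<close> scaled so that
    \<open>v 1 2\<close> has coefficient 1; it remains to see that the relation of \<open>2, j, k\<close> is compatible.\<close>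
  define T where "T j = (if j \<le> 1 then 0 else if j = 2 then 1 else t j)" for j
  have step: "T j < T k \<and>
      (\<forall>a\<in>{1..d}. (T k - T j) * v j k a = T k * v 1 k a - T j * v 1 j a)"
    if jk: "2 < j" "j < k" "k \<le> s" for j k
  proof -
    obtain p q r where pqr: "p > 0" "r > 0" "q = p + r"
        "\<forall>a\<in>{1..d}. p * v 2 j a - q * v 2 k a + r * v j k a = 0"
      using lin_rel_sum[of 2 j k] jk by auto
    \<comment> \<open>The empty sum is not 1, so coordinate 1 exists. Its partner \<open>b\<close>
      serves all triples of \<open>1, 2, j, k\<close> at once; the factorisation needs the same two
      coordinates in all three determinants.\<close>
    have d: "1 \<in> {1..d}"
      using sum_one[of j k] jk by (cases d) auto
    have "(1::nat) < 2" by simp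
    from rank_two[OF le_refl this jk d] obtain b where b: "b \<in> {1..d}"
      and rk_all: "\<forall>i1\<in>{1, 2, j, k}. \<forall>i2\<in>{1, 2, j, k}. \<forall>i3\<in>{1, 2, j, k}. i1 < i2 \<longrightarrow> i2 < i3 \<longrightarrow>
        rank (vector [vector [v i1 i2 1, v i1 i3 1, v i2 i3 1],
                      vector [v i1 i2 b, v i1 i3 b, v i2 i3 b]] :: real^3^2) = 2"
      by (rule bexE)
    note rk = rk_all[rule_format]
    have c: "c \<in> {1..d}" if "c \<in> {1, b}" for c
      using that b d by auto
    have tj: "t j > 1" "t k > 1"
      using t(1) jk by auto
    have minor: "v 1 2 1 * v 2 m b - v 2 m 1 * v 1 2 b \<noteq> 0" if "m \<in> {j, k}" for m
    proof (rule rank_two_imp_minor_nonzero[OF rk])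
      show "1 * v 1 2 1 - t m * v 1 m 1 + (t m - 1) * v 2 m 1 = 0"
        using t(2)[of m 1] that jk d by auto
      show "1 * v 1 2 b - t m * v 1 m b + (t m - 1) * v 2 m b = 0"
        using t(2)[of m b] that jk b by auto
      show "t m \<noteq> 0"
        using tj that by auto
    qed (use that jk in auto)
    \<comment> \<open>The rank condition pairs \<open>v 2 j\<close> with \<open>v j k\<close>, but
      the factorisation pairs \<open>v 2 j\<close> with \<open>v 2 k\<close>. Inserting the relation
      for \<open>r * v j k\<close> shows that the two determinants agree up to the positive factors
      \<open>r\<close> and \<open>q\<close>.\<close>
    have "v 2 j 1 * v j k b - v j k 1 * v 2 j b \<noteq> 0"
      by (rule rank_two_imp_minor_nonzero[OF rk, of _ _ _ p q r]) (use jk pqr b d in auto)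
    moreover have rjk: "r * v j k a = q * v 2 k a - p * v 2 j a" if "a \<in> {1..d}" for a
      using pqr(4) that by (auto simp: algebra_simps)
    have "r * (v 2 j 1 * v j k b - v j k 1 * v 2 j b) =
        q * (v 2 j 1 * v 2 k b - v 2 k 1 * v 2 j b)"
      using rjk[OF d] rjk[OF b] by algebra
    ultimately have minor': "v 2 j 1 * v 2 k b - v 2 k 1 * v 2 j b \<noteq> 0"
      using pqr by auto
    have "b \<noteq> 1"
      using minor[of j] by auto
    then have "det_S2 (S2_minor v 1 2 j k 1 b) = 0"
      using det_zero[of 1 2 j k 1 b] b jk by auto
    moreover have "t j * t k * r * det_S2 (S2_minor v 1 2 j k 1 b) =
        (p * (t k - 1) - q * (t j - 1)) *
        (v 1 2 1 * v 2 j b - v 2 j 1 * v 1 2 b) *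
        (v 1 2 1 * v 2 k b - v 2 k 1 * v 1 2 b) *
        (v 2 j 1 * v 2 k b - v 2 k 1 * v 2 j b)"
      by (rule det_S2_minor_factor) (use jk c t(2) rjk in auto)
    \<comment> \<open>All three determinants are nonzero, so the linear factor must vanish:
      \<open>p\<close> and \<open>q\<close> are in the ratio of \<open>T j - T 2\<close> to
      \<open>T k - T 2\<close>.\<close>
    ultimately have ratio: "p * (t k - 1) = q * (t j - 1)"
      using minor[of j] minor[of k] minor' by simp
    then have pr: "p * (t k - t j) = r * (t j - 1)"
      using pqr(3) by (simp add: algebra_simps)
    moreover have "r * (t j - 1) > 0"
      using pqr tj by simp
    ultimately have less: "t j < t k"
      using pqr(1) by (metis diff_gt_0_iff_gt zero_less_mult_pos)
    have "(t k - t j) * v j k a = t k * v 1 k a - t j * v 1 j a" if a: "a \<in> {1..d}" for a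
    proof -
      \<comment> \<open>The relation of \<open>2, j, k\<close> is rescaled by \<open>ratio\<close>;
        then \<open>v 1 2\<close> cancels between the relations of \<open>1, 2, k\<close> and
        \<open>1, 2, j\<close>.\<close>
      have "p * ((t k - t j) * v j k a) = (t j - 1) * (r * v j k a)"
        using pr by algebra
      also have "\<dots> = (q * (t j - 1)) * v 2 k a - p * ((t j - 1) * v 2 j a)"
        by (simp add: rjk[OF a] algebra_simps)
      also have "\<dots> = p * ((t k - 1) * v 2 k a - (t j - 1) * v 2 j a)"
        unfolding ratio[symmetric] by (simp add: algebra_simps)
      also have "(t k - 1) * v 2 k a - (t j - 1) * v 2 j a = t k * v 1 k a - t j * v 1 j a"
        using t(2)[of k a] t(2)[of j a] a jk by simp
      finally show ?thesis
        using pqr(1) by simp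
    qed
    then show ?thesis
      using less jk by (simp add: T_def)
  qed
  have all: "T i < T j \<and>
      (\<forall>a\<in>{1..d}. (T j - T i) * v i j a = T j * v 1 j a - T i * v 1 i a)"
    if ij: "1 \<le> i" "i < j" "j \<le> s" for i j
  proof -
    consider "i = 1" "j = 2" | "i = 1" "j > 2" | "i = 2" | "i > 2"
      using ij by linarith
    then show ?thesis
    proof cases
      case 2
      then show ?thesis using t(1)[of j] ij by (simp add: T_def)
    next
      case 3
      then show ?thesis using t[of j] ij by (auto simp: T_def)
    next
      case 4
      then show ?thesis using step ij by blast
    qed (simp add: T_def)
  qed
  show thesis
    by (rule that[of T]) (use all in \<open>auto simp: T_def\<close>)
qed

section \<open>Realising a finite distribution on the unit interval\<close>

text \<open>The interval is cut into consecutive half-open pieces of lengths \<open>p x\<close>, and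
  \<open>Z\<close> takes the value \<open>x\<close> on the piece belonging to \<open>x\<close>.
  Points of mass zero get empty pieces.\<close>

lemma finite_distribution_on_unit_interval:
  fixes p :: "'a \<Rightarrow> real"
  assumes fin: "finite A" and nonneg: "\<And>x. x \<in> A \<Longrightarrow> 0 \<le> p x" and total: "sum p A = 1"
  shows "\<exists>Z :: real \<Rightarrow> 'a. Z \<in> measurable (lebesgue_on {0<..1}) (count_space A) \<and>
    (\<forall>B\<subseteq>A. \<P>(t in lebesgue_on {0<..1}. Z t \<in> B) = sum p B)"
proof -
  define N where "N = card A"
  obtain e where e: "bij_betw e {..<N} A"
    using ex_bij_betw_nat_finite[OF fin] by (auto simp: N_def atLeast0LessThan)
  define C where "C n = (\<Sum>k<n. p (e k))" for n
  have C_mono: "C m \<le> C n" if "m \<le> n" "n \<le> N" for m n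
    unfolding C_def
    by (rule sum_mono2) (use that e nonneg in \<open>auto dest!: bij_betwE\<close>)
  have C0: "C 0 = 0" and CN: "C N = 1"
    using total by (simp_all add: C_def sum.reindex_bij_betw[OF e])
  \<comment> \<open>This is the number of the piece containing \<open>t\<close>. On the unit
    interval the search stops before \<open>N\<close> because \<open>C N = 1\<close>, so values of
    \<open>e\<close> outside its domain never matter.\<close>
  define idx where "idx t = (LEAST n. t \<le> C (Suc n))" for t
  define I where "I n = {C n<..C (Suc n)}" for n
  have idx: "t \<in> {0<..1} \<and> idx t = n \<longleftrightarrow> t \<in> I n" if n: "n < N" for n t
  proof
    assume t: "t \<in> {0<..1} \<and> idx t = n"
    have "t \<le> C (Suc (N - 1))"
      using t CN n by simp
    then have "t \<le> C (Suc n)"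
      using t unfolding idx_def by (metis (no_types, lifting) LeastI)
    moreover have "C n < t"
    proof (cases n)
      case 0
      then show ?thesis using C0 t by simp
    next
      case (Suc m)
      then show ?thesis
        using t not_less_Least[of m "\<lambda>n. t \<le> C (Suc n)"] unfolding idx_def by auto
    qed
    ultimately show "t \<in> I n" by (simp add: I_def)
  next
    assume t: "t \<in> I n"
    have "idx t = n"
      unfolding idx_def
    proof (rule Least_equality)
      show "n \<le> m" if "t \<le> C (Suc m)" for m
        using t that n C_mono[of "Suc m" n] by (auto simp: I_def not_le[symmetric] intro: ccontr)
    qed (use t in \<open>simp add: I_def\<close>)
    moreover have "0 \<le> C n" "C (Suc n) \<le> 1"
      using C_mono[of 0 n] C_mono[of "Suc n" N] C0 CN n by auto
    ultimately show "t \<in> {0<..1} \<and> idx t = n"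
      using t by (auto simp: I_def)
  qed
  have idx_less: "idx t < N" if "t \<in> {0<..1}" for t
  proof -
    have "N > 0"
      using C0 CN by (cases N) auto
    then have "idx t \<le> N - 1"
      unfolding idx_def using that CN by (intro Least_le) simp
    then show ?thesis using \<open>N > 0\<close> by linarith
  qed
  define Z where "Z t = e (idx t)" for t
  have preimage: "{t \<in> {0<..1}. Z t = e n} = I n" if "n < N" for n
  proof -
    have "Z t = e n \<longleftrightarrow> idx t = n" if "t \<in> {0<..1}" for t
      using idx_less[OF that] e \<open>n < N\<close> by (auto simp: Z_def bij_betw_def inj_on_def)
    then show ?thesis
      using idx[OF that] by blast
  qed
  have I_sub: "I n \<subseteq> {0<..1}" if "n < N" for n
    using idx[OF that] by blast
  have I_meas: "I n \<in> sets (lebesgue_on {0<..1})" if "n < N" for n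
    using I_sub[OF that] by (auto simp: I_def sets_restrict_space_iff)
  have Z_in: "Z t \<in> A" if "t \<in> {0<..1}" for t
    using idx_less[OF that] e by (auto simp: Z_def dest: bij_betwE)
  have Z_meas: "Z \<in> measurable (lebesgue_on {0<..1}) (count_space A)"
  proof (subst measurable_count_space_eq2[OF fin], intro conjI ballI)
    show "Z \<in> space (lebesgue_on {0<..1}) \<rightarrow> A"
      using Z_in by auto
    fix x assume "x \<in> A"
    then obtain n where "n < N" "x = e n"
      using e by (auto simp: bij_betw_def)
    then show "Z -` {x} \<inter> space (lebesgue_on {0<..1}) \<in> sets (lebesgue_on {0<..1})"
      using preimage[of n] I_meas[of n] by (simp add: vimage_def Int_def conj_commute)
  qed
  have prob_space: "prob_space (lebesgue_on {0<..1::real})"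
    by (rule prob_spaceI) (simp add: emeasure_restrict_space)
  interpret prob_space "lebesgue_on {0<..1::real}" by (rule prob_space)
  have singleton: "\<P>(t in lebesgue_on {0<..1}. Z t = x) = p x" if x: "x \<in> A" for x
  proof -
    obtain n where n: "n < N" "x = e n"
      using e x by (auto simp: bij_betw_def)
    have "\<P>(t in lebesgue_on {0<..1}. Z t = x) = measure lebesgue (I n)"
      using preimage[OF n(1)] I_sub[OF n(1)] n(2) by (simp add: measure_restrict_space)
    also have "\<dots> = C (Suc n) - C n"
      using C_mono[of n "Suc n"] n(1) by (simp add: I_def)
    finally show ?thesis by (simp add: C_def n(2))
  qed
  have "\<P>(t in lebesgue_on {0<..1}. Z t \<in> B) = sum p B" if B: "B \<subseteq> A" for B
  proof -
    have "{t \<in> space (lebesgue_on {0<..1}). Z t \<in> B} =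
        (\<Union>x\<in>B. {t \<in> space (lebesgue_on {0<..1}). Z t = x})"
      by auto
    also have "prob \<dots> = (\<Sum>x\<in>B. \<P>(t in lebesgue_on {0<..1}. Z t = x))"
    proof (rule finite_measure_finite_Union)
      have "{t \<in> space (lebesgue_on {0<..1}). Z t = x} \<in> events" if "x \<in> B" for x
        using measurable_sets[OF Z_meas, of "{x}"] B that
        by (simp add: vimage_def Int_def conj_commute subset_iff)
      then show "(\<lambda>x. {t \<in> space (lebesgue_on {0<..1}). Z t = x}) ` B \<subseteq> events"
        by blast
    qed (use fin B finite_subset in \<open>auto simp: disjoint_family_on_def\<close>)
    also have "\<dots> = sum p B"
      using singleton B by (intro sum.cong) auto
    finally show ?thesis .
  qed
  with Z_meas show ?thesis by (intro exI[of _ Z]) simp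
qed

section \<open>Construction of \<open>X\<close> and \<open>Y\<close>\<close>

theorem theorem4p4:
  fixes v :: "nat \<Rightarrow> nat \<Rightarrow> nat \<Rightarrow> real" and s d :: nat
  assumes prob_vec: "\<And>i j. 1 \<le> i \<Longrightarrow> i < j \<Longrightarrow> j \<le> s \<Longrightarrow>
      (\<forall>a\<in>{1..d}. v i j a \<in> {0..1}) \<and> (\<Sum>a=1..d. v i j a) = 1"
    and lin_rel: "\<And>i j k. 1 \<le> i \<Longrightarrow> i < j \<Longrightarrow> j < k \<Longrightarrow> k \<le> s \<Longrightarrow>
      \<exists>p q r :: real. p > 0 \<and> q > 0 \<and> r > 0 \<and>
        (\<forall>a\<in>{1..d}. p * v i j a - q * v i k a + r * v j k a = 0)"
    and rank_two: "\<And>i j k l a. 1 \<le> i \<Longrightarrow> i < j \<Longrightarrow> j < k \<Longrightarrow> k < l \<Longrightarrow> l \<le> s \<Longrightarrow> a \<in> {1..d} \<Longrightarrow>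
      \<exists>b\<in>{1..d}. \<forall>i1\<in>{i, j, k, l}. \<forall>i2\<in>{i, j, k, l}. \<forall>i3\<in>{i, j, k, l}. i1 < i2 \<longrightarrow> i2 < i3 \<longrightarrow>
        rank (vector [vector [v i1 i2 a, v i1 i3 a, v i2 i3 a],
                      vector [v i1 i2 b, v i1 i3 b, v i2 i3 b]] :: real^3^2) = 2"
    and S2_rank: "S2_rank_one s d v"
  shows "\<exists>X Y :: real \<Rightarrow> nat.
      X \<in> measurable (lebesgue_on {0<..1}) (count_space {1..s}) \<and>
      Y \<in> measurable (lebesgue_on {0<..1}) (count_space {1..d}) \<and>
      (\<forall>i j. 1 \<le> i \<and> i < j \<and> j \<le> s \<longrightarrow>
         \<P>(t in lebesgue_on {0<..1}. i < X t \<and> X t \<le> j) > 0 \<and>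
         (\<forall>a\<in>{1..d}. v i j a =
            \<P>(t in lebesgue_on {0<..1}. Y t = a \<bar> i < X t \<and> X t \<le> j)))"
proof -
  have s: "s \<ge> 2"
    using S2_rank unfolding S2_rank_one_def by fastforce
  obtain T where T1: "T 1 = 0"
    and T_less: "\<And>i j. 1 \<le> i \<Longrightarrow> i < j \<Longrightarrow> j \<le> s \<Longrightarrow> T i < T j"
    and T_eq: "\<And>i j a. 1 \<le> i \<Longrightarrow> i < j \<Longrightarrow> j \<le> s \<Longrightarrow> a \<in> {1..d} \<Longrightarrow>
             (T j - T i) * v i j a = T j * v 1 j a - T i * v 1 i a"
    by (rule common_weights_exist[of s v d])
      (use prob_vec lin_rel rank_two S2_rank in \<open>auto simp: S2_rank_one_def\<close>)
  have Ts: "T s > 0"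
    using T_less[of 1 s] T1 s by simp
  \<comment> \<open>This form telescopes over \<open>m\<close>. At \<open>m = 2\<close> the
    meaningless value \<open>v 1 1 a\<close> appears, but its coefficient \<open>T 1\<close> is
    0.\<close>
  define w where "w m a = (T m * v 1 m a - T (m - 1) * v 1 (m - 1) a) / T s" for m a
  \<comment> \<open>The value 1 of \<open>X\<close> gets no mass: the events \<open>i < X\<close>
    with \<open>i\<close> at least 1 never see it, and the weights from 2 on already add up to
    1.\<close>
  define A where "A = {2..s} \<times> {1..d}"
  define p where "p = (\<lambda>(m, a). w m a)"
  \<comment> \<open>For consecutive indices the weight becomes a positive multiple of a coordinate
    of \<open>v (m - 1) m\<close>, which gives nonnegativity.\<close>
  have w: "w m a = (T m - T (m - 1)) * v (m - 1) m a / T s" if "m \<in> {2..s}" "a \<in> {1..d}" for m a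
    proof -
    have "1 \<le> m - 1" "m - 1 < m" "m \<le> s"
      using that by auto
    from T_eq[OF this that(2)] show ?thesis
      by (simp add: w_def)
  qed
  have w_interval: "(\<Sum>m\<in>{i<..j}. w m a) = (T j - T i) * v i j a / T s"
    if "1 \<le> i" "i < j" "j \<le> s" "a \<in> {1..d}" for i j a
  proof -
    have "(\<Sum>m\<in>{i<..j}. w m a) =
        (\<Sum>m\<in>{i<..j}. T m * v 1 m a - T (m - 1) * v 1 (m - 1) a) / T s"
      by (simp add: w_def sum_divide_distrib)
    also have "(\<Sum>m\<in>{i<..j}. T m * v 1 m a - T (m - 1) * v 1 (m - 1) a) =
        T j * v 1 j a - T i * v 1 i a"
      using sum_telescope''[of i j "\<lambda>m. T m * v 1 m a"] that
      by (simp add: atLeastSucAtMost_greaterThanAtMost)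
    finally show ?thesis
      using T_eq that by simp
  qed
  have w_rectangle: "(\<Sum>m\<in>{i<..j}. \<Sum>a=1..d. w m a) = (T j - T i) / T s"
    if "1 \<le> i" "i < j" "j \<le> s" for i j
  proof -
    have "(\<Sum>m\<in>{i<..j}. \<Sum>a=1..d. w m a) = (\<Sum>a=1..d. \<Sum>m\<in>{i<..j}. w m a)"
      by (rule sum.swap)
    also have "\<dots> = (\<Sum>a=1..d. (T j - T i) * v i j a / T s)"
      using w_interval that by (intro sum.cong) auto
    also have "\<dots> = (T j - T i) * (\<Sum>a=1..d. v i j a) / T s"
      by (simp add: sum_distrib_left sum_divide_distrib)
    finally show ?thesis
      using prob_vec that by simp
  qed
  have "finite A"
    by (simp add: A_def)
  moreover have "0 \<le> p x" if xA: "x \<in> A" for x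
  proof -
    obtain m a where x: "x = (m, a)" "m \<in> {2..s}" "a \<in> {1..d}"
      using xA by (auto simp: A_def)
    have m: "1 \<le> m - 1" "m - 1 < m" "m \<le> s"
      using x(2) by auto
    have "T (m - 1) \<le> T m"
      using T_less[OF m] by simp
    moreover have "0 \<le> v (m - 1) m a"
      using prob_vec[OF m] x(3) by simp
    ultimately show ?thesis
      using w[OF x(2,3)] Ts x(1) by (simp add: p_def)
  qed
  moreover have "sum p A = 1"
  proof -
    have "{2..s} = {1<..s}" by auto
    then show ?thesis
      using w_rectangle[of 1 s] s T1 Ts by (simp add: A_def p_def sum.cartesian_product[symmetric])
  qed
  ultimately have "\<exists>Z :: real \<Rightarrow> nat \<times> nat.
      Z \<in> measurable (lebesgue_on {0<..1}) (count_space A) \<and>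
      (\<forall>B\<subseteq>A. \<P>(t in lebesgue_on {0<..1}. Z t \<in> B) = sum p B)"
    by (rule finite_distribution_on_unit_interval)
  then obtain Z :: "real \<Rightarrow> nat \<times> nat"
    where Z: "Z \<in> measurable (lebesgue_on {0<..1}) (count_space A) \<and>
      (\<forall>B\<subseteq>A. \<P>(t in lebesgue_on {0<..1}. Z t \<in> B) = sum p B)"
    by (rule exE)
  note Z_meas = conjunct1[OF Z] and Z_prob = conjunct2[OF Z, rule_format]
  have Z_in: "fst (Z t) \<in> {2..s}" "snd (Z t) \<in> {1..d}" if "t \<in> {0<..1}" for t
    using measurable_space[OF Z_meas, of t] that by (auto simp: A_def mem_Times_iff)
  define X where "X = fst \<circ> Z"
  define Y where "Y = snd \<circ> Z"
  have X_meas: "X \<in> measurable (lebesgue_on {0<..1}) (count_space {1..s})"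
    unfolding X_def by (rule measurable_comp[OF Z_meas]) (auto simp: A_def)
  have Y_meas: "Y \<in> measurable (lebesgue_on {0<..1}) (count_space {1..d})"
    unfolding Y_def by (rule measurable_comp[OF Z_meas]) (auto simp: A_def)
  have pos_and_cond: "\<P>(t in lebesgue_on {0<..1}. i < X t \<and> X t \<le> j) > 0 \<and>
      (\<forall>a\<in>{1..d}. v i j a = \<P>(t in lebesgue_on {0<..1}. Y t = a \<bar> i < X t \<and> X t \<le> j))"
    if ij: "1 \<le> i" "i < j" "j \<le> s" for i j
  proof -
    have sub: "{i<..j} \<times> S \<subseteq> A" if "S \<subseteq> {1..d}" for S
      using that ij by (auto simp: A_def)
    \<comment> \<open>\<open>Y\<close> always lies in \<open>{1..d}\<close>, so a condition on
      \<open>X\<close> alone is a full rectangle for \<open>Z\<close>.\<close>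
    have "\<P>(t in lebesgue_on {0<..1}. i < X t \<and> X t \<le> j) =
        \<P>(t in lebesgue_on {0<..1}. Z t \<in> {i<..j} \<times> {1..d})"
      using Z_in by (intro arg_cong[where f = "measure _"]) (auto simp: X_def mem_Times_iff)
    also have "\<dots> = (T j - T i) / T s"
      unfolding Z_prob[OF sub[OF subset_refl]]
      using w_rectangle[OF ij] by (simp add: p_def sum.cartesian_product[symmetric])
    finally have X_prob: "\<P>(t in lebesgue_on {0<..1}. i < X t \<and> X t \<le> j) = (T j - T i) / T s" .
    have pos: "(T j - T i) / T s > 0"
      using T_less[OF ij] Ts by simp
    have "v i j a = \<P>(t in lebesgue_on {0<..1}. Y t = a \<bar> i < X t \<and> X t \<le> j)"
      if a: "a \<in> {1..d}" for a
    proof -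
      have "\<P>(t in lebesgue_on {0<..1}. Y t = a \<and> i < X t \<and> X t \<le> j) =
          \<P>(t in lebesgue_on {0<..1}. Z t \<in> {i<..j} \<times> {a})"
        by (intro arg_cong[where f = "measure _"]) (auto simp: X_def Y_def mem_Times_iff)
      \<comment> \<open>The joint probability is that of the condition times \<open>v i j a\<close>,
        so division by the positive \<open>X_prob\<close> value leaves the coordinate.\<close>
      also have "\<dots> = (T j - T i) / T s * v i j a"
        using w_interval[OF ij a] a
        by (subst Z_prob[OF sub]) (simp_all add: p_def sum.cartesian_product[symmetric])
      finally show ?thesis
        using pos unfolding cond_prob_def X_prob by (auto simp: zero_less_divide_iff)
    qed
    then show ?thesis
      using X_prob pos by simp
  qed
  show ?thesis
    using X_meas Y_meas pos_and_cond by blast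
qed

end
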